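(* $(F^1_{USCG}(\widetilde X), H_{\rm end})$ is a completion of $(F^1_{USCG}(X), H_{\rm end})$, where $(F^1_{USCG}(X),H_{\rm end})$ is regarded as a subspace of $(F^1_{USCG}(\widetilde X),H_{\rm end})$ via the isometric embedding $j$ extending each $u$ by $0$ on $\widetilde X\setminus X$. That is, $(F^1_{USCG}(\widetilde X), H_{\rm end})$ is a complete metric space and $j(F^1_{USCG}(X))$ is dense in it.
   Context: $(X,d)$ is a nonempty metric space and $(\widetilde X,\widetilde d)$ is its completion, with $X$ viewed as a (dense) subspace of $\widetilde X$. For any metric space $(Y,\rho)$, $Y\times[0,1]$ carries the metric $\overline\rho((x,\alpha),(y,\beta))=\rho(x,y)+|\alpha-\beta|$; $C(Y)$ and $K(Y)$ denote the sets of nonempty closed, respectively nonempty compact, subsets of $Y$; and $H(A,B)=\max\{\sup_{a\in A}\inf_{b\in B}\overline\rho(a,b),\ \sup_{b\in B}\inf_{a\in A}\overline\rho(a,b)\}$ is the Hausdorff distance on $C(Y\times[0,1])$. A fuzzy set in $Y$ is a function $u:Y\to[0,1]$, with $[u]_\alpha=\{x\in Y:u(x)\ge\alpha\}$ for $\alpha\in(0,1]$ and $[u]_0=\overline{\{x\in Y:u(x)>0\}}$. $F^1_{USC}(Y)$ is the set of fuzzy sets $u$ in $Y$ with $[u]_\alpha\in C(Y)$ for all $\alpha\in[0,1]$; $F^1_{USCG}(Y)=\{u\in F^1_{USC}(Y):[u]_\alpha\in K(Y)\text{ for all }\alpha\in(0,1]\}$. The endograph is ${\rm end}\,u=\{(x,t)\in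 Y\times[0,1]:u(x)\ge t\}$, and $H_{\rm end}(u,v)=H({\rm end}\,u,{\rm end}\,v)$, a metric on $F^1_{USC}(Y)$. For a fuzzy set $u$ in $X$, $j(u)$ is the fuzzy set in $\widetilde X$ with $j(u)(t)=u(t)$ for $t\in X$ and $j(u)(t)=0$ for $t\in\widetilde X\setminus X$. *)

theory Defs
  imports "HOL-Analysis.Analysis"
begin

definition metric_completion ::
  "'a set \<Rightarrow> ('a \<Rightarrow> 'a \<Rightarrow> real) \<Rightarrow> 'b set \<Rightarrow> ('b \<Rightarrow> 'b \<Rightarrow> real) \<Rightarrow> ('a \<Rightarrow> 'b) \<Rightarrow> bool" where
  "metric_completion M d M' d' f \<longleftrightarrow>
     Metric_space M d \<and> Metric_space M' d' \<and> Metric_space.mcomplete M' d' \<and>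
     f \<in> M \<rightarrow> M' \<and> (\<forall>x\<in>M. \<forall>y\<in>M. d' (f x) (f y) = d x y) \<and>
     (Metric_space.mtopology M' d') closure_of (f ` M) = M'"

definition nonempty_closed :: "'a set \<Rightarrow> ('a \<Rightarrow> 'a \<Rightarrow> real) \<Rightarrow> 'a set set" where
  "nonempty_closed Y \<rho> = {A. A \<noteq> {} \<and> closedin (Metric_space.mtopology Y \<rho>) A}"

definition nonempty_compact :: "'a set \<Rightarrow> ('a \<Rightarrow> 'a \<Rightarrow> real) \<Rightarrow> 'a set set" where
  "nonempty_compact Y \<rho> = {A. A \<noteq> {} \<and> compactin (Metric_space.mtopology Y \<rho>) A}"

definition prod_dist :: "('a \<Rightarrow> 'a \<Rightarrow> real) \<Rightarrow> 'a \<times> real \<Rightarrow> 'a \<times> real \<Rightarrow> real" where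
  "prod_dist \<rho> p q = \<rho> (fst p) (fst q) + \<bar>snd p - snd q\<bar>"

text \<open>The Hausdorff distance between closed sets may be infinite, so it takes values in
  \<^typ>\<open>ennreal\<close>; all suprema and infima are then genuine.\<close>

definition hausdorff :: "('c \<Rightarrow> 'c \<Rightarrow> real) \<Rightarrow> 'c set \<Rightarrow> 'c set \<Rightarrow> ennreal" where
  "hausdorff \<rho> A B =
     max (SUP a\<in>A. INF b\<in>B. ennreal (\<rho> a b)) (SUP b\<in>B. INF a\<in>A. ennreal (\<rho> a b))"

text \<open>Fuzzy sets in \<open>Y\<close> are extensional (\<^const>\<open>undefined\<close> off the carrier \<open>Y\<close>), so that equality
  of functions is equality on \<open>Y\<close>.\<close>

definition fuzzy_sets :: "'a set \<Rightarrow> ('a \<Rightarrow> real) set" where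
  "fuzzy_sets Y = (Y \<rightarrow>\<^sub>E {0..1})"

definition fuzzy_cut ::
  "'a set \<Rightarrow> ('a \<Rightarrow> 'a \<Rightarrow> real) \<Rightarrow> ('a \<Rightarrow> real) \<Rightarrow> real \<Rightarrow> 'a set" where
  "fuzzy_cut Y \<rho> u \<alpha> =
     (if \<alpha> = 0 then (Metric_space.mtopology Y \<rho>) closure_of {x \<in> Y. u x > 0}
      else {x \<in> Y. u x \<ge> \<alpha>})"

definition F_USC :: "'a set \<Rightarrow> ('a \<Rightarrow> 'a \<Rightarrow> real) \<Rightarrow> ('a \<Rightarrow> real) set" where
  "F_USC Y \<rho> = {u \<in> fuzzy_sets Y. \<forall>\<alpha>\<in>{0..1}. fuzzy_cut Y \<rho> u \<alpha> \<in> nonempty_closed Y \<rho>}"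

definition F_USCG :: "'a set \<Rightarrow> ('a \<Rightarrow> 'a \<Rightarrow> real) \<Rightarrow> ('a \<Rightarrow> real) set" where
  "F_USCG Y \<rho> = {u \<in> F_USC Y \<rho>. \<forall>\<alpha>\<in>{0<..1}. fuzzy_cut Y \<rho> u \<alpha> \<in> nonempty_compact Y \<rho>}"

definition endograph :: "'a set \<Rightarrow> ('a \<Rightarrow> real) \<Rightarrow> ('a \<times> real) set" where
  "endograph Y u = {(x, t). x \<in> Y \<and> t \<in> {0..1} \<and> u x \<ge> t}"

definition H_end ::
  "'a set \<Rightarrow> ('a \<Rightarrow> 'a \<Rightarrow> real) \<Rightarrow> ('a \<Rightarrow> real) \<Rightarrow> ('a \<Rightarrow> real) \<Rightarrow> real" where
  "H_end Y \<rho> u v = enn2real (hausdorff (prod_dist \<rho>) (endograph Y u) (endograph Y v))"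

text \<open>Endographs have finite Hausdorff distance, since each of them contains \<open>Y \<times> {0}\<close>; hence
  no information is lost by \<^const>\<open>enn2real\<close> in \<^const>\<open>H_end\<close>.\<close>

lemma hausdorff_endograph_le_1:
  assumes "Metric_space Y \<rho>" "u \<in> fuzzy_sets Y" "v \<in> fuzzy_sets Y"
  shows "hausdorff (prod_dist \<rho>) (endograph Y u) (endograph Y v) \<le> 1"
proof -
  interpret Metric_space Y \<rho> by fact
  have base: "(x, 0) \<in> endograph Y w" if "x \<in> Y" "w \<in> fuzzy_sets Y" for x w
    using that by (auto simp: endograph_def fuzzy_sets_def PiE_iff)
  have "(INF q\<in>endograph Y v. ennreal (prod_dist \<rho> p q)) \<le> 1" if "p \<in> endograph Y u" for p
    using that
    by (intro INF_lower2[of "(fst p, 0)"] base[OF _ assms(3)]) (auto simp: endograph_def prod_dist_def)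
  moreover have "(INF p\<in>endograph Y u. ennreal (prod_dist \<rho> p q)) \<le> 1" if "q \<in> endograph Y v" for q
    using that
    by (intro INF_lower2[of "(fst q, 0)"] base[OF _ assms(2)]) (auto simp: endograph_def prod_dist_def)
  ultimately show ?thesis
    unfolding hausdorff_def by (auto intro!: SUP_least)
qed

lemma ennreal_H_end:
  assumes "Metric_space Y \<rho>" "u \<in> fuzzy_sets Y" "v \<in> fuzzy_sets Y"
  shows "ennreal (H_end Y \<rho> u v) = hausdorff (prod_dist \<rho>) (endograph Y u) (endograph Y v)"
  unfolding H_end_def using hausdorff_endograph_le_1[OF assms]
  by (intro ennreal_enn2real) (auto simp: le_less_trans)

definition zero_ext :: "'a set \<Rightarrow> 'a set \<Rightarrow> ('a \<Rightarrow> real) \<Rightarrow> ('a \<Rightarrow> real)" where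
  "zero_ext X Y u = (\<lambda>t\<in>Y. if t \<in> X then u t else 0)"

end

theory Submission
  imports Defs
begin

text \<open>
  For a fuzzy set \<open>v\<close>, the distance from a point \<open>(x, t)\<close> to the endograph of \<open>v\<close> is the infimum over
  \<open>y\<close> of \<open>\<rho> x y + max 0 (t - v y)\<close>. It increases with \<open>t\<close>, so the excess of one
  endograph over another is governed by the points \<open>(x, u x)\<close> of the graph alone. All estimates are
  therefore made with the relation \<open>endo_near \<epsilon> u v\<close> (every \<open>(x, u x)\<close> is closer than \<open>\<epsilon>\<close> to the
  endograph of \<open>v\<close>), which composes additively and determines \<^const>\<open>H_end\<close>
  (\<open>H_end_less_imp_endo_near\<close>, \<open>endo_near_imp_H_end_le\<close>). Membership in \<^const>\<open>F_USCG\<close> amounts to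
  compact cuts at positive levels together with the value 1 being attained (\<open>F_USCG_iff\<close>).

  Completeness (\<open>mcomplete_F_USCG\<close>). The limit of an endograph-Cauchy sequence \<open>\<sigma>\<close> is read off from the
  Kuratowski lower limit of the endographs: its value at \<open>x\<close> is the largest \<open>t\<close> such that the distance
  from \<open>(x, t)\<close> to the endograph of \<open>\<sigma> n\<close> tends to 0. The Cauchy condition makes this convergence
  uniform in \<open>x\<close>. Conversely, a point of a late endograph is followed along ever later members of the
  sequence with geometrically decreasing steps; as the base space is complete, the chain ends at a
  nearby point of the limit endograph. Positive cuts of the limit are closed, and totally bounded
  because each lies near a compact cut of some \<open>\<sigma> n\<close>; the value 1 is attained since values arbitrarily
  close to 1 occur inside a single compact cut.

  Isometry (\<open>H_end_zero_ext\<close>). A point of \<open>Y - X\<close> carries the value 0 under an extension by zero,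
  so it cannot approximate a point better than the point on the axis directly below it does.

  Density (\<open>zero_ext_dense\<close>). Given \<open>v\<close> and \<open>\<epsilon>\<close>, finitely many \<open>\<epsilon>\<close>-balls centred in \<open>X\<close> cover the
  compact cut of \<open>v\<close> at level \<open>\<epsilon>\<close>. The finitely supported fuzzy set taking at each centre the
  supremum of \<open>v\<close> over the ball has endograph distance at most \<open>2 * \<epsilon>\<close> from \<open>v\<close>; the supremum,
  rather than the value of \<open>v\<close> at some nearby point, is what controls both excesses and preserves the
  value 1.
\<close>

section \<open>The endograph metric through one-sided approximation\<close>

context Metric_space
begin

text \<open>For \<open>v\<close> with values in the unit interval and \<open>t \<ge> 0\<close> this says that the distance from
  \<open>(x, t)\<close> to the endograph of \<open>v\<close> is less than \<open>\<epsilon>\<close>: the two inequalities together express \<open>d x y + max 0 (t - v y) < \<epsilon>\<close>, in a form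
  suited to linear arithmetic.\<close>

definition close_to_endo :: "('a \<Rightarrow> real) \<Rightarrow> 'a \<Rightarrow> real \<Rightarrow> real \<Rightarrow> bool" where
  "close_to_endo v x t \<epsilon> \<longleftrightarrow> (\<exists>y\<in>M. d x y < \<epsilon> \<and> d x y + (t - v y) < \<epsilon>)"

definition endo_near :: "real \<Rightarrow> ('a \<Rightarrow> real) \<Rightarrow> ('a \<Rightarrow> real) \<Rightarrow> bool" where
  "endo_near \<epsilon> u v \<longleftrightarrow> (\<forall>x\<in>M. close_to_endo v x (u x) \<epsilon>)"

text \<open>The distance to a fixed set is 1-Lipschitz, and lowering a point brings it no further from
  an endograph; so apart from the horizontal move only a raise \<open>\<delta>\<close> of the height costs anything.\<close>

lemma close_to_endo_move:
  assumes "close_to_endo v x t \<epsilon>" "x \<in> M" "x' \<in> M" "t' \<le> t + \<delta>" "0 \<le> \<delta>"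
  shows "close_to_endo v x' t' (\<epsilon> + d x x' + \<delta>)"
proof -
  obtain y where y: "y \<in> M" "d x y < \<epsilon>" "d x y + (t - v y) < \<epsilon>"
    using assms(1) unfolding close_to_endo_def by blast
  have "d x' y \<le> d x x' + d x y"
    using triangle''[of x' x y] assms y by simp
  then show ?thesis
    unfolding close_to_endo_def using y assms by (intro bexI[of _ y]) auto
qed

lemma close_to_endo_trans:
  assumes "close_to_endo u x t a" "endo_near b u v" "x \<in> M"
  shows "close_to_endo v x t (a + b)"
proof -
  obtain y where y: "y \<in> M" "d x y < a" "d x y + (t - u y) < a"
    using assms(1) unfolding close_to_endo_def by blast
  obtain z where z: "z \<in> M" "d y z < b" "d y z + (u y - v z) < b"
    using assms(2) y unfolding endo_near_def close_to_endo_def by blast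
  have "d x z \<le> d x y + d y z"
    using triangle assms y z by simp
  then show ?thesis
    unfolding close_to_endo_def using y z by (intro bexI[of _ z]) auto
qed

lemma endo_near_trans:
  "endo_near a u v \<Longrightarrow> endo_near b v w \<Longrightarrow> endo_near (a + b) u w"
  using close_to_endo_trans unfolding endo_near_def[of _ u] by blast

lemma prod_dist_commute: "prod_dist d p q = prod_dist d q p"
  unfolding prod_dist_def by (rule arg_cong2[of _ _ _ _ "(+)", OF commute abs_minus_commute])

lemma hausdorff_eq_max_excess:
  "hausdorff (prod_dist d) A B =
     max (SUP p\<in>A. INF q\<in>B. ennreal (prod_dist d p q)) (SUP q\<in>B. INF p\<in>A. ennreal (prod_dist d q p))"
proof -
  have "(INF p\<in>A. ennreal (prod_dist d p q)) = (INF p\<in>A. ennreal (prod_dist d q p))" for q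
    by (rule INF_cong[OF refl]) (rule arg_cong[OF prod_dist_commute])
  then show ?thesis
    unfolding hausdorff_def by (simp only:)
qed

lemma hausdorff_commute: "hausdorff (prod_dist d) A B = hausdorff (prod_dist d) B A"
  unfolding hausdorff_eq_max_excess by (rule max.commute)

lemma H_end_commute: "H_end M d u v = H_end M d v u"
  by (simp add: H_end_def hausdorff_commute)

lemma hausdorff_less_imp_endo_near:
  assumes u: "u \<in> fuzzy_sets M"
    and less: "hausdorff (prod_dist d) (endograph M u) (endograph M v) < ennreal \<epsilon>"
  shows "endo_near \<epsilon> u v"
  unfolding endo_near_def
proof
  fix x assume x: "x \<in> M"
  have mem: "(x, u x) \<in> endograph M u"
    using u x by (auto simp: endograph_def fuzzy_sets_def PiE_iff)
  have "(INF q\<in>endograph M v. ennreal (prod_dist d (x, u x) q))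
      \<le> (SUP p\<in>endograph M u. INF q\<in>endograph M v. ennreal (prod_dist d p q))"
    using SUP_upper[OF mem, of "\<lambda>p. INF q\<in>endograph M v. ennreal (prod_dist d p q)"] by simp
  also have "\<dots> \<le> hausdorff (prod_dist d) (endograph M u) (endograph M v)"
    by (simp add: hausdorff_def)
  finally have "(INF q\<in>endograph M v. ennreal (prod_dist d (x, u x) q)) < ennreal \<epsilon>"
    using less by simp
  then obtain y s where y: "(y, s) \<in> endograph M v" "ennreal (prod_dist d (x, u x) (y, s)) < ennreal \<epsilon>"
    by (auto simp: INF_less_iff)
  then have "d x y + \<bar>u x - s\<bar> < \<epsilon>"
    by (simp add: prod_dist_def ennreal_less_iff del: ennreal_plus)
  then show "close_to_endo v x (u x) \<epsilon>"
    unfolding close_to_endo_def using y(1)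
    by (intro bexI[of _ y]) (auto simp: endograph_def)
qed

lemma H_end_less_imp_endo_near:
  assumes "u \<in> fuzzy_sets M" "v \<in> fuzzy_sets M" "H_end M d u v < \<epsilon>"
  shows "endo_near \<epsilon> u v"
proof (rule hausdorff_less_imp_endo_near)
  have "0 \<le> H_end M d u v" by (simp add: H_end_def)
  then have "ennreal (H_end M d u v) < ennreal \<epsilon>"
    using assms(3) by (simp add: ennreal_less_iff)
  then show "hausdorff (prod_dist d) (endograph M u) (endograph M v) < ennreal \<epsilon>"
    by (simp add: ennreal_H_end[OF Metric_space_axioms assms(1,2)])
qed fact

text \<open>A point below \<open>(x, u x)\<close> inherits the approximating base point \<open>y\<close> of \<open>(x, u x)\<close>.\<close>

lemma endo_near_imp_excess_le:
  assumes v: "v \<in> fuzzy_sets M" and near: "endo_near \<epsilon> u v"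
  shows "(SUP p\<in>endograph M u. INF q\<in>endograph M v. ennreal (prod_dist d p q)) \<le> ennreal \<epsilon>"
proof (rule SUP_least)
  fix p assume p: "p \<in> endograph M u"
  obtain x t where p_eq: "p = (x, t)" and x: "x \<in> M" and t: "0 \<le> t" "t \<le> 1" "t \<le> u x"
    using p by (auto simp: endograph_def)
  obtain y where y: "y \<in> M" "d x y < \<epsilon>" "d x y + (u x - v y) < \<epsilon>"
    using near x unfolding endo_near_def close_to_endo_def by blast
  have "0 \<le> v y" using v y by (auto simp: fuzzy_sets_def PiE_iff)
  \<comment> \<open>Truncating \<open>t\<close> at \<open>v y\<close> gives the point above \<open>y\<close> in the endograph of \<open>v\<close> closest to \<open>p\<close>.\<close>
  then have "(y, min t (v y)) \<in> endograph M v"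
    using t y by (auto simp: endograph_def)
  moreover have "prod_dist d p (y, min t (v y)) \<le> \<epsilon>"
    using y t by (auto simp: prod_dist_def p_eq min_def)
  ultimately show "(INF q\<in>endograph M v. ennreal (prod_dist d p q)) \<le> ennreal \<epsilon>"
    by (intro INF_lower2[of "(y, min t (v y))"] ennreal_leI)
qed

lemma endo_near_imp_H_end_le:
  assumes "u \<in> fuzzy_sets M" "v \<in> fuzzy_sets M" "endo_near \<epsilon> u v" "endo_near \<epsilon> v u" "0 \<le> \<epsilon>"
  shows "H_end M d u v \<le> \<epsilon>"
proof -
  have "hausdorff (prod_dist d) (endograph M u) (endograph M v) \<le> ennreal \<epsilon>"
    by (subst hausdorff_eq_max_excess)
      (rule max.boundedI[OF endo_near_imp_excess_le[OF assms(2,3)] endo_near_imp_excess_le[OF assms(1,4)]])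
  then show ?thesis
    unfolding H_end_def by (rule enn2real_leI[OF assms(5)])
qed

section \<open>Fuzzy sets with compact positive cuts form a metric space\<close>

text \<open>Compact sets of a metric space are closed and the cut at level 0 is a closure, so compactness at
  positive levels yields closedness at all levels. Cuts decrease with the level, so they are all nonempty
  as soon as the cut at level 1 is.\<close>

lemma F_USCG_iff:
  "u \<in> F_USCG M d \<longleftrightarrow> u \<in> fuzzy_sets M \<and>
     (\<forall>\<alpha>\<in>{0<..1}. compactin mtopology {x \<in> M. \<alpha> \<le> u x}) \<and> (\<exists>x\<in>M. u x = 1)"
  (is "_ \<longleftrightarrow> ?R")
proof
  assume u: "u \<in> F_USCG M d"
  then have f: "u \<in> fuzzy_sets M" by (simp add: F_USCG_def F_USC_def)
  have "fuzzy_cut M d u 1 \<in> nonempty_closed M d"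
    using u by (simp add: F_USCG_def F_USC_def)
  then obtain x where "x \<in> M" "1 \<le> u x"
    by (auto simp: fuzzy_cut_def nonempty_closed_def)
  then have "\<exists>x\<in>M. u x = 1"
    using f by (intro bexI[of _ x]) (auto simp: fuzzy_sets_def PiE_iff intro: antisym)
  moreover have "\<forall>\<alpha>\<in>{0<..1}. compactin mtopology {x \<in> M. \<alpha> \<le> u x}"
    using u by (auto simp: F_USCG_def nonempty_compact_def fuzzy_cut_def)
  ultimately show ?R using f by blast
next
  assume R: ?R
  then obtain x where x: "x \<in> M" "u x = 1" by blast
  have c: "compactin mtopology {x \<in> M. \<alpha> \<le> u x}" if "0 < \<alpha>" "\<alpha> \<le> 1" for \<alpha>
    using R that by auto
  have "x \<in> mtopology closure_of {x \<in> M. 0 < u x}"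
    using x closure_of_subset[of "{x \<in> M. 0 < u x}" mtopology] by auto
  then have "fuzzy_cut M d u \<alpha> \<in> nonempty_closed M d" if "0 \<le> \<alpha>" "\<alpha> \<le> 1" for \<alpha>
    using that x c[of \<alpha>] compactin_imp_closedin[OF Hausdorff_space_mtopology]
    by (auto simp: fuzzy_cut_def nonempty_closed_def)
  then show "u \<in> F_USCG M d"
    using R x unfolding F_USCG_def F_USC_def nonempty_compact_def
    by (auto simp: fuzzy_cut_def)
qed

lemma F_USCG_fuzzy: "u \<in> F_USCG M d \<Longrightarrow> u \<in> fuzzy_sets M"
  by (simp add: F_USCG_iff)

lemma F_USCG_cut_compactin:
  "u \<in> F_USCG M d \<Longrightarrow> 0 < \<alpha> \<Longrightarrow> \<alpha> \<le> 1 \<Longrightarrow> compactin mtopology {x \<in> M. \<alpha> \<le> u x}"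
  by (simp add: F_USCG_iff)

text \<open>Base points approximating \<open>(x, u x)\<close> converge to \<open>x\<close> inside any cut of \<open>v\<close> at a level below
  \<open>u x\<close>, and these cuts are closed. This gives the separation axiom for \<^const>\<open>H_end\<close>.\<close>

lemma endo_near_all_imp_le:
  assumes u: "u \<in> F_USCG M d" and v: "v \<in> F_USCG M d"
    and near: "\<And>\<epsilon>. 0 < \<epsilon> \<Longrightarrow> endo_near \<epsilon> u v" and x: "x \<in> M"
  shows "u x \<le> v x"
proof (rule dense_le)
  fix \<alpha> assume \<alpha>: "\<alpha> < u x"
  show "\<alpha> \<le> v x"
  proof (cases "0 < \<alpha>")
    case False
    then show ?thesis using F_USCG_fuzzy[OF v] x by (force simp: fuzzy_sets_def PiE_iff)
  next
    case True
    have "u x \<le> 1" using F_USCG_fuzzy[OF u] x by (auto simp: fuzzy_sets_def PiE_iff)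
    then have "compactin mtopology {y \<in> M. \<alpha> \<le> v y}"
      using True \<alpha> by (intro F_USCG_cut_compactin[OF v]) auto
    then have "closedin mtopology {y \<in> M. \<alpha> \<le> v y}"
      using compactin_imp_closedin Hausdorff_space_mtopology by blast
    moreover have "x \<in> mtopology closure_of {y \<in> M. \<alpha> \<le> v y}"
      unfolding metric_closure_of
    proof (clarsimp simp: x)
      fix r :: real assume "0 < r"
      then have "endo_near (min r (u x - \<alpha>)) u v" using \<alpha> by (intro near) auto
      then obtain y where y: "y \<in> M" "d x y < min r (u x - \<alpha>)" "d x y + (u x - v y) < min r (u x - \<alpha>)"
        using x unfolding endo_near_def close_to_endo_def by blast
      have "0 \<le> d x y" by simp
      then have "\<alpha> \<le> v y" using y(3) by linarith
      then show "\<exists>y. y \<in> M \<and> \<alpha> \<le> v y \<and> d x y < r"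
        using y by auto
    qed
    ultimately show ?thesis by (simp add: closure_of_closedin)
  qed
qed

lemma Metric_space_F_USCG: "Metric_space (F_USCG M d) (H_end M d)"
proof
  fix u v w
  show "0 \<le> H_end M d u v" by (simp add: H_end_def)
  show "H_end M d u v = H_end M d v u" by (rule H_end_commute)
  assume u: "u \<in> F_USCG M d" and v: "v \<in> F_USCG M d"
  show "H_end M d u v = 0 \<longleftrightarrow> u = v"
  proof
    assume 0: "H_end M d u v = 0"
    then have "endo_near \<epsilon> u v" "endo_near \<epsilon> v u" if "0 < \<epsilon>" for \<epsilon>
      using H_end_less_imp_endo_near u v that by (auto simp: F_USCG_fuzzy H_end_commute)
    then have "u x = v x" if "x \<in> M" for x
      using that u v by (intro antisym endo_near_all_imp_le)
    with F_USCG_fuzzy[OF u] F_USCG_fuzzy[OF v] show "u = v"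
      unfolding fuzzy_sets_def by (rule PiE_ext)
  next
    assume "u = v"
    have "endo_near \<epsilon> v v" if "0 < \<epsilon>" for \<epsilon>
      unfolding endo_near_def close_to_endo_def
    proof
      fix x assume "x \<in> M"
      then show "\<exists>y\<in>M. d x y < \<epsilon> \<and> d x y + (v x - v y) < \<epsilon>"
        using that by (intro bexI[of _ x]) auto
    qed
    then have "H_end M d u v \<le> 0 + \<epsilon>" if "0 < \<epsilon>" for \<epsilon>
      using that v \<open>u = v\<close> by (simp add: endo_near_imp_H_end_le F_USCG_fuzzy)
    then have "H_end M d u v \<le> 0" by (rule field_le_epsilon)
    then show "H_end M d u v = 0" by (simp add: H_end_def order_antisym)
  qed
  assume w: "w \<in> F_USCG M d"
  show "H_end M d u w \<le> H_end M d u v + H_end M d v w"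
  proof (rule field_le_epsilon)
    fix e :: real assume e: "0 < e"
    have near: "endo_near (H_end M d p q + e/2) p q" if "p \<in> F_USCG M d" "q \<in> F_USCG M d" for p q
      using H_end_less_imp_endo_near that e by (simp add: F_USCG_fuzzy)
    let ?a = "H_end M d u v + e/2" and ?b = "H_end M d v w + e/2"
    have "endo_near (?a + ?b) u w"
      using endo_near_trans[OF near near] u v w by blast
    moreover have "endo_near (?b + ?a) w u"
      using endo_near_trans[OF near near, of w v u] u v w by (simp add: H_end_commute)
    moreover have "0 \<le> ?a + ?b" using e by (simp add: H_end_def)
    ultimately have "H_end M d u w \<le> ?a + ?b"
      using u w by (intro endo_near_imp_H_end_le) (auto simp: F_USCG_fuzzy add_ac)
    then show "H_end M d u w \<le> H_end M d u v + H_end M d v w + e" by simp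
  qed
qed

section \<open>Limits of endographs\<close>

text \<open>Membership of \<open>(x, t)\<close> in the Kuratowski lower limit of the endographs of \<open>\<sigma> n\<close>.\<close>

definition endo_limit_point :: "(nat \<Rightarrow> 'a \<Rightarrow> real) \<Rightarrow> 'a \<Rightarrow> real \<Rightarrow> bool" where
  "endo_limit_point \<sigma> x t \<longleftrightarrow> (\<forall>\<epsilon>>0. \<exists>N. \<forall>n\<ge>N. close_to_endo (\<sigma> n) x t \<epsilon>)"

definition endo_limit :: "(nat \<Rightarrow> 'a \<Rightarrow> real) \<Rightarrow> 'a \<Rightarrow> real" where
  "endo_limit \<sigma> = (\<lambda>x\<in>M. Sup {t\<in>{0..1}. endo_limit_point \<sigma> x t})"

lemma endo_limit_point_closed:
  assumes "x \<in> M"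
    and "\<And>\<epsilon>. 0 < \<epsilon> \<Longrightarrow> \<exists>y\<in>M. \<exists>s. d x y < \<epsilon> \<and> t < s + \<epsilon> \<and> endo_limit_point \<sigma> y s"
  shows "endo_limit_point \<sigma> x t"
  unfolding endo_limit_point_def
proof (intro allI impI)
  fix \<epsilon> :: real assume "0 < \<epsilon>"
  then obtain y s where y: "y \<in> M" "d x y < \<epsilon>/3" "t < s + \<epsilon>/3" "endo_limit_point \<sigma> y s"
    using assms(2)[of "\<epsilon>/3"] by auto
  then obtain N where N: "\<And>n. n \<ge> N \<Longrightarrow> close_to_endo (\<sigma> n) y s (\<epsilon>/3)"
    using \<open>0 < \<epsilon>\<close> unfolding endo_limit_point_def by (meson divide_pos_pos zero_less_numeral)
  have "close_to_endo (\<sigma> n) x t \<epsilon>" if "n \<ge> N" for n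
  proof -
    have "close_to_endo (\<sigma> n) x t (\<epsilon>/3 + d y x + (2*\<epsilon>/3 - d y x))"
      using N[OF that] y assms(1) \<open>0 < \<epsilon>\<close> commute[of x y] by (intro close_to_endo_move[of _ y s]) auto
    then show ?thesis by simp
  qed
  then show "\<exists>N. \<forall>n\<ge>N. close_to_endo (\<sigma> n) x t \<epsilon>" by blast
qed

lemma endo_limit_point_0:
  assumes "\<And>n. \<sigma> n \<in> fuzzy_sets M" "x \<in> M"
  shows "endo_limit_point \<sigma> x 0"
proof -
  have "0 \<le> \<sigma> n x" for n
    using assms(1)[of n] assms(2) by (auto simp: fuzzy_sets_def PiE_iff)
  then have "close_to_endo (\<sigma> n) x 0 \<epsilon>" if "0 < \<epsilon>" for n \<epsilon>
    unfolding close_to_endo_def using that assms(2)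
    by (intro bexI[of _ x]) (auto intro: le_less_trans[of _ 0])
  then show ?thesis unfolding endo_limit_point_def by blast
qed

lemma endo_limit_upper:
  assumes "endo_limit_point \<sigma> x t" "0 \<le> t" "t \<le> 1" "x \<in> M"
  shows "t \<le> endo_limit \<sigma> x"
proof -
  have "t \<le> Sup {t\<in>{0..1}. endo_limit_point \<sigma> x t}"
    using assms by (intro cSup_upper) (auto intro!: bdd_aboveI[of _ 1])
  then show ?thesis using assms by (simp add: endo_limit_def)
qed

lemma endo_limit_fuzzy:
  assumes "\<And>n. \<sigma> n \<in> fuzzy_sets M"
  shows "endo_limit \<sigma> \<in> fuzzy_sets M"
proof -
  have "endo_limit \<sigma> x \<in> {0..1}" if x: "x \<in> M" for x
  proof -
    have "Sup {t\<in>{0..1}. endo_limit_point \<sigma> x t} \<le> 1"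
    proof (rule cSup_least)
      show "{t\<in>{0..1}. endo_limit_point \<sigma> x t} \<noteq> {}"
        using endo_limit_point_0[of \<sigma>, OF assms x] by fastforce
    qed auto
    then show ?thesis
      using endo_limit_upper[OF endo_limit_point_0[of \<sigma>, OF assms x]] x by (simp add: endo_limit_def)
  qed
  then show ?thesis
    by (auto simp: fuzzy_sets_def endo_limit_def)
qed

text \<open>The supremum defining \<open>endo_limit\<close> is attained, because lower limits of sets are closed.\<close>

lemma endo_limit_point_endo_limit:
  assumes "\<And>n. \<sigma> n \<in> fuzzy_sets M" "x \<in> M"
  shows "endo_limit_point \<sigma> x (endo_limit \<sigma> x)"
proof (rule endo_limit_point_closed[OF assms(2)])
  fix \<epsilon> :: real assume e: "0 < \<epsilon>"
  let ?T = "{t\<in>{0..1}. endo_limit_point \<sigma> x t}"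
  have "endo_limit \<sigma> x - \<epsilon> < Sup ?T"
    using assms e by (simp add: endo_limit_def)
  moreover have "?T \<noteq> {}" using endo_limit_point_0[of \<sigma>, OF assms] by fastforce
  ultimately obtain s where "s \<in> ?T" "endo_limit \<sigma> x - \<epsilon> < s"
    using less_cSupD[of ?T "endo_limit \<sigma> x - \<epsilon>"] by blast
  then show "\<exists>y\<in>M. \<exists>s. d x y < \<epsilon> \<and> endo_limit \<sigma> x < s + \<epsilon> \<and> endo_limit_point \<sigma> y s"
    using assms(2) e by (intro bexI[of _ x] exI[of _ s]) simp_all
qed

text \<open>Upper semicontinuity of the limit, in a quantitative form in which the approximating points may
  also fall slightly short of the level \<open>\<alpha>\<close>.\<close>

lemma endo_limit_closed:
  assumes \<sigma>: "\<And>n. \<sigma> n \<in> fuzzy_sets M" and x: "x \<in> M" and \<alpha>: "0 \<le> \<alpha>" "\<alpha> \<le> 1"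
    and approx: "\<And>\<epsilon>. 0 < \<epsilon> \<Longrightarrow> \<exists>y\<in>M. d x y < \<epsilon> \<and> \<alpha> < endo_limit \<sigma> y + \<epsilon>"
  shows "\<alpha> \<le> endo_limit \<sigma> x"
proof (rule endo_limit_upper[OF _ \<alpha> x], rule endo_limit_point_closed[OF x])
  fix \<epsilon> :: real assume "0 < \<epsilon>"
  then obtain y where "y \<in> M" "d x y < \<epsilon>" "\<alpha> < endo_limit \<sigma> y + \<epsilon>"
    using approx by blast
  with endo_limit_point_endo_limit[of \<sigma>, OF \<sigma>]
  show "\<exists>y\<in>M. \<exists>s. d x y < \<epsilon> \<and> \<alpha> < s + \<epsilon> \<and> endo_limit_point \<sigma> y s"
    by (intro bexI[of _ y] exI[of _ "endo_limit \<sigma> y"]) simp_all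
qed

lemma geometric_chain_limit:
  assumes complete: mcomplete
    and \<xi>: "\<And>k::nat. \<xi> k \<in> M" "\<And>k. d (\<xi> k) (\<xi> (Suc k)) < \<epsilon> / 2^k" and "0 < \<epsilon>"
  obtains y where "limitin mtopology \<xi> y sequentially" "y \<in> M" "d (\<xi> 0) y \<le> 2*\<epsilon>"
proof -
  have dist: "d (\<xi> k) (\<xi> (k+j)) \<le> 2*\<epsilon>/2^k - 2*\<epsilon>/2^(k+j)" for k j
  proof (induction j)
    case 0
    then show ?case using \<xi> by simp
  next
    case (Suc j)
    have "d (\<xi> k) (\<xi> (k + Suc j)) \<le> d (\<xi> k) (\<xi> (k+j)) + d (\<xi> (k+j)) (\<xi> (Suc (k+j)))"
      using triangle \<xi> by simp
    also have "\<dots> \<le> 2*\<epsilon>/2^k - 2*\<epsilon>/2^(k+j) + \<epsilon>/2^(k+j)"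
      using Suc \<xi>(2)[of "k+j"] by linarith
    also have "\<dots> = 2*\<epsilon>/2^k - 2*\<epsilon>/2^(k+Suc j)"
      by (simp add: field_simps)
    finally show ?case .
  qed
  have dist': "d (\<xi> k) (\<xi> (k+j)) \<le> 2*\<epsilon>/2^k" for k j
  proof -
    have "0 \<le> 2*\<epsilon>/2^(k+j)" using \<open>0 < \<epsilon>\<close> by simp
    then show ?thesis using dist[of k j] by linarith
  qed
  have "MCauchy \<xi>"
    unfolding MCauchy_def
  proof (intro conjI allI impI)
    show "range \<xi> \<subseteq> M" using \<xi> by blast
    fix \<eta> :: real assume "0 < \<eta>"
    have "eventually (\<lambda>k. 4*\<epsilon> / 2^k < \<eta>) sequentially"
      using order_tendstoD(2)[OF LIMSEQ_divide_realpow_zero \<open>0 < \<eta>\<close>] by simp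
    then obtain k where k: "4*\<epsilon> / 2^k < \<eta>"
      unfolding eventually_sequentially by blast
    have "d (\<xi> m) (\<xi> n) < \<eta>" if "k \<le> m" "k \<le> n" for m n
    proof -
      have "d (\<xi> k) (\<xi> m) \<le> 2*\<epsilon>/2^k" "d (\<xi> k) (\<xi> n) \<le> 2*\<epsilon>/2^k"
        using dist'[of k "m-k"] dist'[of k "n-k"] that by auto
      moreover have "d (\<xi> m) (\<xi> n) \<le> d (\<xi> k) (\<xi> m) + d (\<xi> k) (\<xi> n)"
        using triangle'' \<xi>(1) by blast
      ultimately show ?thesis using k by simp
    qed
    then show "\<exists>N. \<forall>m n. N \<le> m \<longrightarrow> N \<le> n \<longrightarrow> d (\<xi> m) (\<xi> n) < \<eta>" by blast
  qed
  then obtain y where y: "limitin mtopology \<xi> y sequentially"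
    using complete unfolding mcomplete_def by blast
  then have "y \<in> M" using limitin_mspace by blast
  have "d (\<xi> 0) y \<le> 2*\<epsilon>"
  proof (rule field_le_epsilon)
    fix e :: real assume "0 < e"
    then obtain n where "d (\<xi> n) y < e"
      using y unfolding limit_metric_sequentially by blast
    then show "d (\<xi> 0) y \<le> 2*\<epsilon> + e"
      using triangle[of "\<xi> 0" "\<xi> n" y] dist'[of 0 n] \<xi> \<open>y \<in> M\<close> by simp
  qed
  with y \<open>y \<in> M\<close> that show thesis by blast
qed

text \<open>This is where completeness of the base space enters. Starting at \<open>(x, \<sigma> n x)\<close>, one moves to nearby
  points of the graphs of later and later members; the \<open>k\<close>-th step costs at most \<open>\<epsilon>/2^k\<close> both in
  distance and in height. The base points converge to some \<open>y\<close> with \<open>d x y \<le> 2 * \<epsilon>\<close>, no height along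
  the chain is more than \<open>2 * \<epsilon>\<close> below \<open>\<sigma> n x\<close>, and hence the limit has height at least
  \<open>\<sigma> n x - 2 * \<epsilon>\<close> at \<open>y\<close>.\<close>

lemma endo_near_Cauchy_reaches_limit:
  assumes complete: mcomplete
    and \<sigma>: "\<And>n. \<sigma> n \<in> fuzzy_sets M"
    and cauchy: "\<And>\<epsilon>. 0 < \<epsilon> \<Longrightarrow> \<exists>N. \<forall>m\<ge>N. \<forall>n\<ge>N. endo_near \<epsilon> (\<sigma> m) (\<sigma> n)"
    and "0 < \<epsilon>"
  shows "\<exists>N. \<forall>n\<ge>N. endo_near (5*\<epsilon>) (\<sigma> n) (endo_limit \<sigma>)"
proof -
  have "\<forall>k::nat. \<exists>N. \<forall>m\<ge>N. \<forall>n\<ge>N. endo_near (\<epsilon>/2^k) (\<sigma> m) (\<sigma> n)"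
    using cauchy \<open>0 < \<epsilon>\<close> by simp
  then obtain K where K: "\<And>k m n. m \<ge> K k \<Longrightarrow> n \<ge> K k \<Longrightarrow> endo_near (\<epsilon>/2^k) (\<sigma> m) (\<sigma> n)"
    by metis
  have "close_to_endo (endo_limit \<sigma>) x (\<sigma> n x) (5*\<epsilon>)" if n: "n \<ge> K 0" and x: "x \<in> M" for n x
  proof -
    \<comment> \<open>Indices along the chain: \<open>\<nu> k\<close> is late enough for all tolerances up to the \<open>k\<close>-th, and
      \<open>\<nu> 0 = n\<close>.\<close>
    define \<nu> where "\<nu> k = max n (Max (K ` {..k}))" for k :: nat
    have \<nu>0: "\<nu> 0 = n" using n by (simp add: \<nu>_def)
    have \<nu>: "K k \<le> \<nu> l" if "k \<le> l" for k l
      using that by (simp add: \<nu>_def le_max_iff_disj)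
    let ?Q = "\<lambda>(k::nat) x y. d x y < \<epsilon>/2^k \<and> d x y + (\<sigma> (\<nu> k) x - \<sigma> (\<nu> (Suc k)) y) < \<epsilon>/2^k"
    have "\<exists>\<xi>. \<forall>k::nat. (\<xi> k \<in> M \<and> (k = 0 \<longrightarrow> \<xi> k = x)) \<and> ?Q k (\<xi> k) (\<xi> (Suc k))"
    proof (rule dependent_nat_choice)
      show "\<exists>y. y \<in> M \<and> ((0::nat) = 0 \<longrightarrow> y = x)" using x by blast
      fix y and k :: nat assume "y \<in> M \<and> (k = 0 \<longrightarrow> y = x)"
      moreover have "endo_near (\<epsilon>/2^k) (\<sigma> (\<nu> k)) (\<sigma> (\<nu> (Suc k)))"
        by (intro K \<nu>) auto
      ultimately show "\<exists>z. (z \<in> M \<and> (Suc k = 0 \<longrightarrow> z = x)) \<and> ?Q k y z"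
        unfolding endo_near_def close_to_endo_def by blast
    qed
    then obtain \<xi> where \<xi>: "\<And>k. \<xi> k \<in> M" "\<xi> 0 = x" and Q: "\<And>k. ?Q k (\<xi> k) (\<xi> (Suc k))"
      by metis
    obtain y where lim: "limitin mtopology \<xi> y sequentially" and y: "y \<in> M" "d x y \<le> 2*\<epsilon>"
      using geometric_chain_limit[of \<xi> \<epsilon>, OF complete \<xi>(1) conjunct1[OF Q] \<open>0 < \<epsilon>\<close>] \<xi>(2) by metis
    have loss: "\<sigma> n x - \<sigma> (\<nu> k) (\<xi> k) \<le> 2*\<epsilon> - 2*\<epsilon>/2^k" for k
    proof (induction k)
      case (Suc k)
      have "0 \<le> d (\<xi> k) (\<xi> (Suc k))" by simp
      then have "\<sigma> n x - \<sigma> (\<nu> (Suc k)) (\<xi> (Suc k)) \<le> 2*\<epsilon> - 2*\<epsilon>/2^k + \<epsilon>/2^k"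
        using Suc Q[of k] by linarith
      also have "\<dots> = 2*\<epsilon> - 2*\<epsilon>/2^Suc k" by (simp add: field_simps)
      finally show ?case .
    qed (simp add: \<nu>0 \<xi>)
    \<comment> \<open>Truncation at 0 keeps \<open>t\<close> in the unit interval; the graphs still lie above \<open>t\<close>, having
      nonnegative values.\<close>
    define t where "t = max 0 (\<sigma> n x - 2*\<epsilon>)"
    have t_le: "t \<le> \<sigma> (\<nu> k) (\<xi> k)" for k
    proof -
      have "0 \<le> \<sigma> (\<nu> k) (\<xi> k)" using \<sigma>[of "\<nu> k"] \<xi> by (auto simp: fuzzy_sets_def PiE_iff)
      moreover have "0 \<le> 2*\<epsilon>/2^k" using \<open>0 < \<epsilon>\<close> by simp
      ultimately show ?thesis using loss[of k] by (simp add: t_def)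
    qed
    have "endo_limit_point \<sigma> y t"
      unfolding endo_limit_point_def
    proof (intro allI impI)
      fix \<eta> :: real assume "0 < \<eta>"
      have "eventually (\<lambda>k. \<epsilon>/2^k < \<eta>/2) sequentially"
        using \<open>0 < \<eta>\<close> by (intro order_tendstoD(2)[OF LIMSEQ_divide_realpow_zero]) simp_all
      moreover have "eventually (\<lambda>k. \<xi> k \<in> M \<and> d (\<xi> k) y < \<eta>/2) sequentially"
        using lim \<open>0 < \<eta>\<close> unfolding limitin_metric by (meson half_gt_zero)
      ultimately have "eventually (\<lambda>k. \<epsilon>/2^k < \<eta>/2 \<and> d (\<xi> k) y < \<eta>/2) sequentially"
        by eventually_elim blast
      then obtain k where k: "\<epsilon>/2^k < \<eta>/2" "d (\<xi> k) y < \<eta>/2"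
        unfolding eventually_sequentially by blast
      have "close_to_endo (\<sigma> m) y t \<eta>" if "m \<ge> \<nu> k" for m
      proof -
        have "endo_near (\<epsilon>/2^k) (\<sigma> (\<nu> k)) (\<sigma> m)"
          using that \<nu>[of k k] by (intro K) auto
        then have "close_to_endo (\<sigma> m) (\<xi> k) (\<sigma> (\<nu> k) (\<xi> k)) (\<epsilon>/2^k)"
          using \<xi> unfolding endo_near_def by blast
        then have "close_to_endo (\<sigma> m) y t (\<epsilon>/2^k + d (\<xi> k) y + (\<eta> - \<epsilon>/2^k - d (\<xi> k) y))"
          using \<xi> y k t_le[of k] by (intro close_to_endo_move[of _ "\<xi> k"]) auto
        then show ?thesis by simp
      qed
      then show "\<exists>N. \<forall>n\<ge>N. close_to_endo (\<sigma> n) y t \<eta>" by blast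
    qed
    moreover have "\<sigma> n x \<le> 1" using \<sigma>[of n] x by (auto simp: fuzzy_sets_def PiE_iff)
    ultimately have "t \<le> endo_limit \<sigma> y"
      using \<open>0 < \<epsilon>\<close> y by (intro endo_limit_upper) (auto simp: t_def)
    then show ?thesis
      unfolding close_to_endo_def using y \<open>0 < \<epsilon>\<close>
      by (intro bexI[of _ y]) (auto simp: t_def)
  qed
  then show ?thesis unfolding endo_near_def by blast
qed

text \<open>Pointwise convergence of the distances to 0 becomes uniform: from \<open>(x, endo_limit \<sigma> x)\<close> one
  passes to some \<open>\<sigma> m\<close> with \<open>m\<close> depending on \<open>x\<close>, and from there to \<open>\<sigma> n\<close> by the Cauchy condition,
  whose threshold does not depend on \<open>x\<close>.\<close>

lemma endo_limit_near_endo_near_Cauchy: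
  assumes \<sigma>: "\<And>n. \<sigma> n \<in> fuzzy_sets M"
    and cauchy: "\<And>\<epsilon>. 0 < \<epsilon> \<Longrightarrow> \<exists>N. \<forall>m\<ge>N. \<forall>n\<ge>N. endo_near \<epsilon> (\<sigma> m) (\<sigma> n)"
    and "0 < \<epsilon>"
  shows "\<exists>N. \<forall>n\<ge>N. endo_near (2*\<epsilon>) (endo_limit \<sigma>) (\<sigma> n)"
proof -
  obtain N where N: "\<And>m n. m \<ge> N \<Longrightarrow> n \<ge> N \<Longrightarrow> endo_near \<epsilon> (\<sigma> m) (\<sigma> n)"
    using cauchy[OF \<open>0 < \<epsilon>\<close>] by blast
  have "close_to_endo (\<sigma> n) x (endo_limit \<sigma> x) (2*\<epsilon>)" if "n \<ge> N" "x \<in> M" for n x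
  proof -
    obtain N' where "\<And>m. m \<ge> N' \<Longrightarrow> close_to_endo (\<sigma> m) x (endo_limit \<sigma> x) \<epsilon>"
      using endo_limit_point_endo_limit[of \<sigma>, OF \<sigma> \<open>x \<in> M\<close>] \<open>0 < \<epsilon>\<close> unfolding endo_limit_point_def by blast
    then have "close_to_endo (\<sigma> n) x (endo_limit \<sigma> x) (\<epsilon> + \<epsilon>)"
      using N[of "max N N'" n] that by (intro close_to_endo_trans[of "\<sigma> (max N N')"]) auto
    then show ?thesis by simp
  qed
  then show ?thesis unfolding endo_near_def by blast
qed

section \<open>Completeness\<close>

text \<open>Total boundedness asks for nets inside \<open>S\<close>; moving each useful centre into \<open>S\<close> at most doubles
  the radius.\<close>

lemma mtotally_bounded_external_net:
  assumes "S \<subseteq> M" "\<And>\<epsilon>. 0 < \<epsilon> \<Longrightarrow> \<exists>K. finite K \<and> K \<subseteq> M \<and> S \<subseteq> (\<Union>x\<in>K. mball x \<epsilon>)"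
  shows "mtotally_bounded S"
  unfolding mtotally_bounded_def
proof (intro allI impI)
  fix \<epsilon> :: real assume "0 < \<epsilon>"
  then obtain K where K: "finite K" "K \<subseteq> M" "S \<subseteq> (\<Union>x\<in>K. mball x (\<epsilon>/2))"
    using assms(2)[of "\<epsilon>/2"] by auto
  define K' where "K' = {x\<in>K. S \<inter> mball x (\<epsilon>/2) \<noteq> {}}"
  have "\<forall>x\<in>K'. \<exists>y. y \<in> S \<inter> mball x (\<epsilon>/2)"
    unfolding K'_def by blast
  from bchoice[OF this] obtain f where f: "\<And>x. x \<in> K' \<Longrightarrow> f x \<in> S \<inter> mball x (\<epsilon>/2)"
    by blast
  have "S \<subseteq> (\<Union>x\<in>f ` K'. mball x \<epsilon>)"
  proof
    fix y assume y: "y \<in> S"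
    then obtain x where x: "x \<in> K" "y \<in> mball x (\<epsilon>/2)" using K by blast
    then have "x \<in> K'" using y by (auto simp: K'_def)
    then have "f x \<in> mball x (\<epsilon>/2)" using f by blast
    then have "y \<in> mball (f x) \<epsilon>"
      using x triangle''[of "f x" x y] by auto
    then show "y \<in> (\<Union>x\<in>f ` K'. mball x \<epsilon>)" using \<open>x \<in> K'\<close> by blast
  qed
  moreover have "finite (f ` K')" "f ` K' \<subseteq> S" using K f by (auto simp: K'_def)
  ultimately show "\<exists>K. finite K \<and> K \<subseteq> S \<and> S \<subseteq> (\<Union>x\<in>K. mball x \<epsilon>)" by blast
qed

text \<open>If \<open>\<delta> \<le> \<alpha>/2\<close>, points of height at least \<open>\<alpha>\<close> are approximated within \<open>\<delta>\<close> only by points of height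
  at least \<open>\<alpha>/2\<close>. Hence the cut of the limit at \<open>\<alpha>\<close> lies near the cut of some \<open>\<sigma> n\<close> at \<open>\<alpha>/2\<close>, and a
  finite net of this compact set is also one for the cut of the limit.\<close>

lemma endo_limit_cut_compactin:
  assumes complete: mcomplete
    and \<sigma>: "\<And>n. \<sigma> n \<in> F_USCG M d"
    and near: "\<And>\<epsilon>. 0 < \<epsilon> \<Longrightarrow> \<exists>n. endo_near \<epsilon> (endo_limit \<sigma>) (\<sigma> n)"
    and \<alpha>: "0 < \<alpha>" "\<alpha> \<le> 1"
  shows "compactin mtopology {x \<in> M. \<alpha> \<le> endo_limit \<sigma> x}"
proof -
  let ?S = "{x \<in> M. \<alpha> \<le> endo_limit \<sigma> x}"
  have "closedin mtopology ?S"
    unfolding metric_closedin_iff_sequentially_closed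
  proof (intro conjI allI impI)
    fix \<tau> l assume \<tau>: "range \<tau> \<subseteq> ?S \<and> limitin mtopology \<tau> l sequentially"
    then have l: "l \<in> M" using limitin_mspace by blast
    have "\<alpha> \<le> endo_limit \<sigma> l"
    proof (rule endo_limit_closed[of \<sigma>, OF F_USCG_fuzzy[OF \<sigma>] l])
      fix \<epsilon> :: real assume "0 < \<epsilon>"
      then obtain n where "d (\<tau> n) l < \<epsilon>"
        using \<tau> unfolding limit_metric_sequentially by blast
      moreover have "\<tau> n \<in> ?S" using \<tau> by blast
      ultimately show "\<exists>y\<in>M. d l y < \<epsilon> \<and> \<alpha> < endo_limit \<sigma> y + \<epsilon>"
        using \<open>0 < \<epsilon>\<close> commute[of l] by (intro bexI[of _ "\<tau> n"]) auto
    qed (use \<alpha> in auto)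
    then show "l \<in> ?S" using l by blast
  qed blast
  moreover have "mtotally_bounded ?S"
  proof (rule mtotally_bounded_external_net)
    fix \<epsilon> :: real assume "0 < \<epsilon>"
    define \<delta> where "\<delta> = min (\<epsilon>/2) (\<alpha>/2)"
    have \<delta>: "0 < \<delta>" "\<delta> \<le> \<epsilon>/2" "\<delta> \<le> \<alpha>/2" using \<open>0 < \<epsilon>\<close> \<alpha> by (auto simp: \<delta>_def)
    obtain n where n: "endo_near \<delta> (endo_limit \<sigma>) (\<sigma> n)" using near \<delta> by blast
    have "compactin mtopology {x \<in> M. \<alpha>/2 \<le> \<sigma> n x}"
      using \<alpha> by (intro F_USCG_cut_compactin[OF \<sigma>]) auto
    then obtain K where K: "finite K" "K \<subseteq> {x \<in> M. \<alpha>/2 \<le> \<sigma> n x}"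
        "{x \<in> M. \<alpha>/2 \<le> \<sigma> n x} \<subseteq> (\<Union>x\<in>K. mball x (\<epsilon>/2))"
      using compactin_imp_mtotally_bounded \<open>0 < \<epsilon>\<close> unfolding mtotally_bounded_def
      by (meson half_gt_zero)
    have "?S \<subseteq> (\<Union>x\<in>K. mball x \<epsilon>)"
    proof
      fix x assume x: "x \<in> ?S"
      then obtain y where y: "y \<in> M" "d x y < \<delta>" "d x y + (endo_limit \<sigma> x - \<sigma> n y) < \<delta>"
        using n unfolding endo_near_def close_to_endo_def by blast
      have "0 \<le> d x y" "\<alpha> \<le> endo_limit \<sigma> x" using x by auto
      then have "\<alpha>/2 \<le> \<sigma> n y" using y \<delta> by linarith
      then obtain z where z: "z \<in> K" "y \<in> mball z (\<epsilon>/2)" using K y by blast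
      then have "x \<in> mball z \<epsilon>" using y x \<delta> triangle'[of z y x] by auto
      then show "x \<in> (\<Union>x\<in>K. mball x \<epsilon>)" using z by blast
    qed
    then show "\<exists>K. finite K \<and> K \<subseteq> M \<and> ?S \<subseteq> (\<Union>x\<in>K. mball x \<epsilon>)" using K by blast
  qed blast
  ultimately show ?thesis
    using mtotally_bounded_eq_compact_closure_of[OF complete, of ?S] by (simp add: closure_of_closedin)
qed

text \<open>Near a point where \<open>\<sigma> n\<close> is 1 the limit is almost 1. A sequence of points with values tending to 1
  stays in the compact cut at level \<open>1/2\<close>, and upper semicontinuity applies at a cluster point.\<close>

lemma endo_limit_attains_1:
  assumes \<sigma>: "\<And>n. \<sigma> n \<in> F_USCG M d"
    and near: "\<And>\<epsilon>. 0 < \<epsilon> \<Longrightarrow> \<exists>n. endo_near \<epsilon> (\<sigma> n) (endo_limit \<sigma>)"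
    and compact: "compactin mtopology {x \<in> M. 1/2 \<le> endo_limit \<sigma> x}"
  shows "\<exists>x\<in>M. endo_limit \<sigma> x = 1"
proof -
  have high: "\<exists>y\<in>M. 1 - \<epsilon> < endo_limit \<sigma> y" if "0 < \<epsilon>" for \<epsilon>
  proof -
    obtain n where n: "endo_near \<epsilon> (\<sigma> n) (endo_limit \<sigma>)" using near \<open>0 < \<epsilon>\<close> by blast
    obtain x where x: "x \<in> M" "\<sigma> n x = 1" using \<sigma>[of n] by (auto simp: F_USCG_iff)
    then obtain y where y: "y \<in> M" "d x y + (1 - endo_limit \<sigma> y) < \<epsilon>"
      using n unfolding endo_near_def close_to_endo_def by metis
    have "0 \<le> d x y" by simp
    then have "1 - \<epsilon> < endo_limit \<sigma> y" using y by linarith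
    then show ?thesis using y by blast
  qed
  \<comment> \<open>The shift by 2 puts even the first term of the sequence into the cut at level \<open>1/2\<close>.\<close>
  have "\<forall>k::nat. \<exists>y\<in>M. 1 - 1 / real (k+2) < endo_limit \<sigma> y"
    using high by auto
  then obtain \<tau> where \<tau>: "\<And>k. \<tau> k \<in> M" "\<And>k::nat. 1 - 1 / real (k+2) < endo_limit \<sigma> (\<tau> k)"
    by metis
  have "1/2 \<le> endo_limit \<sigma> (\<tau> k)" for k
  proof -
    have "1 / real (k+2) \<le> 1/2" by (simp add: field_simps)
    then show ?thesis using \<tau>(2)[of k] by linarith
  qed
  then have "range \<tau> \<subseteq> {x \<in> M. 1/2 \<le> endo_limit \<sigma> x}" using \<tau> by blast
  then obtain l r where r: "strict_mono r" and l: "limitin mtopology (\<tau> \<circ> r) l sequentially"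
    using compact unfolding compactin_sequentially by blast
  have "l \<in> M" using l limitin_mspace by blast
  have "1 \<le> endo_limit \<sigma> l"
  proof (rule endo_limit_closed[of \<sigma>, OF F_USCG_fuzzy[OF \<sigma>] \<open>l \<in> M\<close>])
    fix \<epsilon> :: real assume "0 < \<epsilon>"
    then obtain N where N: "\<And>n. n \<ge> N \<Longrightarrow> d (\<tau> (r n)) l < \<epsilon>"
      using l unfolding limit_metric_sequentially by (metis comp_apply)
    obtain k where k: "1 / real (Suc k) < \<epsilon>"
      using \<open>0 < \<epsilon>\<close> nat_approx_posE by blast
    let ?n = "max N k"
    have "k \<le> r ?n" using seq_suble[OF r, of ?n] by simp
    then have "1 / real (r ?n + 2) \<le> 1 / real (Suc k)" by (simp add: field_simps)
    then have "1 < endo_limit \<sigma> (\<tau> (r ?n)) + \<epsilon>" using k \<tau>(2)[of "r ?n"] by linarith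
    then show "\<exists>y\<in>M. d l y < \<epsilon> \<and> 1 < endo_limit \<sigma> y + \<epsilon>"
      using N[of ?n] \<tau>(1) commute[of l] by (intro bexI[of _ "\<tau> (r ?n)"]) auto
  qed auto
  moreover have "endo_limit \<sigma> l \<le> 1"
    using endo_limit_fuzzy[of \<sigma>, OF F_USCG_fuzzy[OF \<sigma>]] \<open>l \<in> M\<close> by (auto simp: fuzzy_sets_def PiE_iff)
  ultimately show ?thesis using \<open>l \<in> M\<close> by (intro bexI[of _ l]) auto
qed

lemma mcomplete_F_USCG:
  assumes complete: mcomplete
  shows "Metric_space.mcomplete (F_USCG M d) (H_end M d)"
proof -
  interpret F: Metric_space "F_USCG M d" "H_end M d" by (rule Metric_space_F_USCG)
  show ?thesis
    unfolding F.mcomplete_def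
  proof (intro allI impI)
    fix \<sigma> assume C: "F.MCauchy \<sigma>"
    then have \<sigma>: "\<sigma> n \<in> F_USCG M d" for n unfolding F.MCauchy_def by blast
    note fz = F_USCG_fuzzy[OF \<sigma>]
    have cauchy: "\<exists>N. \<forall>m\<ge>N. \<forall>n\<ge>N. endo_near \<epsilon> (\<sigma> m) (\<sigma> n)" if "0 < \<epsilon>" for \<epsilon>
    proof -
      obtain N where "\<And>m n. N \<le> m \<Longrightarrow> N \<le> n \<Longrightarrow> H_end M d (\<sigma> m) (\<sigma> n) < \<epsilon>"
        using C \<open>0 < \<epsilon>\<close> unfolding F.MCauchy_def by blast
      then show ?thesis using H_end_less_imp_endo_near[OF fz fz] by blast
    qed
    let ?u = "endo_limit \<sigma>"
    have from_\<sigma>: "\<exists>N. \<forall>n\<ge>N. endo_near \<epsilon> (\<sigma> n) ?u" if "0 < \<epsilon>" for \<epsilon>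
      using endo_near_Cauchy_reaches_limit[of \<sigma> "\<epsilon>/5", OF complete fz cauchy] that by simp
    have to_\<sigma>: "\<exists>N. \<forall>n\<ge>N. endo_near \<epsilon> ?u (\<sigma> n)" if "0 < \<epsilon>" for \<epsilon>
      using endo_limit_near_endo_near_Cauchy[of \<sigma> "\<epsilon>/2", OF fz cauchy] that by simp
    have "compactin mtopology {x \<in> M. \<alpha> \<le> ?u x}" if "0 < \<alpha>" "\<alpha> \<le> 1" for \<alpha>
      using endo_limit_cut_compactin[of \<sigma>, OF complete \<sigma> _ that] to_\<sigma> by blast
    moreover from this[of "1/2"] have "\<exists>x\<in>M. ?u x = 1"
      using endo_limit_attains_1[of \<sigma>, OF \<sigma>] from_\<sigma> by fastforce
    ultimately have u: "?u \<in> F_USCG M d"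
      unfolding F_USCG_iff using endo_limit_fuzzy[of \<sigma>, OF fz] by auto
    have "\<exists>N. \<forall>n\<ge>N. H_end M d (\<sigma> n) ?u < \<epsilon>" if "0 < \<epsilon>" for \<epsilon>
    proof -
      obtain N1 where "\<forall>n\<ge>N1. endo_near (\<epsilon>/2) (\<sigma> n) ?u"
        using from_\<sigma>[OF half_gt_zero[OF \<open>0 < \<epsilon>\<close>]] by blast
      moreover obtain N2 where "\<forall>n\<ge>N2. endo_near (\<epsilon>/2) ?u (\<sigma> n)"
        using to_\<sigma>[OF half_gt_zero[OF \<open>0 < \<epsilon>\<close>]] by blast
      ultimately have "H_end M d (\<sigma> n) ?u \<le> \<epsilon>/2" if "n \<ge> max N1 N2" for n
        using that \<open>0 < \<epsilon>\<close> by (intro endo_near_imp_H_end_le fz F_USCG_fuzzy[OF u]) simp_all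
      moreover have "\<epsilon>/2 < \<epsilon>" using \<open>0 < \<epsilon>\<close> by simp
      ultimately show ?thesis by (meson le_less_trans)
    qed
    then have "limitin F.mtopology \<sigma> ?u sequentially"
      unfolding F.limit_metric_sequentially using u \<sigma> by simp
    then show "\<exists>u. limitin F.mtopology \<sigma> u sequentially" by (rule exI[of _ ?u])
  qed
qed

end

section \<open>Extension by zero\<close>

lemma zero_ext_fuzzy:
  "u \<in> fuzzy_sets X \<Longrightarrow> zero_ext X Y u \<in> fuzzy_sets Y"
  by (auto simp: fuzzy_sets_def zero_ext_def PiE_iff)

lemma mtopology_cong:
  assumes "Metric_space X d" "Metric_space X d'" "\<And>x y. x \<in> X \<Longrightarrow> y \<in> X \<Longrightarrow> d x y = d' x y"
  shows "Metric_space.mtopology X d = Metric_space.mtopology X d'"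
proof -
  interpret A: Metric_space X d by fact
  interpret B: Metric_space X d' by fact
  have "A.mball x r = B.mball x r" for x r
    using assms(3) by (auto simp: A.mball_def B.mball_def)
  then show ?thesis
    by (simp add: topology_eq A.openin_mtopology B.openin_mtopology)
qed

lemma zero_ext_F_USCG:
  assumes X: "Metric_space X d" and Y: "Metric_space Y \<rho>" and sub: "X \<subseteq> Y"
    and eq: "\<And>x y. x \<in> X \<Longrightarrow> y \<in> X \<Longrightarrow> \<rho> x y = d x y"
    and u: "u \<in> F_USCG X d"
  shows "zero_ext X Y u \<in> F_USCG Y \<rho>"
proof -
  interpret X: Metric_space X d by fact
  interpret Y: Metric_space Y \<rho> by fact
  interpret S: Submetric Y \<rho> X using sub by unfold_locales
  have top: "X.mtopology = subtopology Y.mtopology X"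
    using mtopology_cong[OF X S.sub.Metric_space_axioms] eq S.mtopology_submetric by simp
  have "{x \<in> Y. \<alpha> \<le> zero_ext X Y u x} = {x \<in> X. \<alpha> \<le> u x}" if "0 < \<alpha>" for \<alpha>
    using sub that by (auto simp: zero_ext_def split: if_splits)
  moreover have "compactin Y.mtopology {x \<in> X. \<alpha> \<le> u x}" if "0 < \<alpha>" "\<alpha> \<le> 1" for \<alpha>
    using u that unfolding X.F_USCG_iff top by (auto simp: compactin_subtopology)
  moreover obtain x where "x \<in> X" "u x = 1" using u by (auto simp: X.F_USCG_iff)
  ultimately show ?thesis
    using sub zero_ext_fuzzy[OF X.F_USCG_fuzzy[OF u]] unfolding Y.F_USCG_iff
    by (auto simp: zero_ext_def intro!: bexI[of _ x])
qed

text \<open>Points of \<open>Y - X\<close> change nothing on either side: as a point to be approximated, such a point has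
  height 0 and approximates itself, and as an approximating point it has height 0 and can be replaced
  by the approximated point's own base point.\<close>

lemma endo_near_zero_ext:
  assumes X: "Metric_space X d" and Y: "Metric_space Y \<rho>" and sub: "X \<subseteq> Y"
    and eq: "\<And>x y. x \<in> X \<Longrightarrow> y \<in> X \<Longrightarrow> \<rho> x y = d x y"
    and u: "u \<in> fuzzy_sets X" and v: "v \<in> fuzzy_sets X" and "0 < \<epsilon>"
  shows "Metric_space.endo_near Y \<rho> \<epsilon> (zero_ext X Y u) (zero_ext X Y v)
     \<longleftrightarrow> Metric_space.endo_near X d \<epsilon> u v"
proof -
  interpret X: Metric_space X d by fact
  interpret Y: Metric_space Y \<rho> by fact
  let ?j = "zero_ext X Y"
  have j: "?j w x = w x" if "x \<in> X" for w x using that sub by (auto simp: zero_ext_def)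
  have j0: "?j w x = 0" if "x \<in> Y" "x \<notin> X" for w x using that by (auto simp: zero_ext_def)
  have v0: "0 \<le> v x" if "x \<in> X" for x using v that by (auto simp: fuzzy_sets_def PiE_iff)
  show ?thesis
  proof
    assume near: "Y.endo_near \<epsilon> (?j u) (?j v)"
    show "X.endo_near \<epsilon> u v"
      unfolding X.endo_near_def X.close_to_endo_def
    proof
      fix x assume x: "x \<in> X"
      then have "x \<in> Y" using sub by blast
      then obtain y where y: "y \<in> Y" "\<rho> x y < \<epsilon>" "\<rho> x y + (?j u x - ?j v y) < \<epsilon>"
        using near unfolding Y.endo_near_def Y.close_to_endo_def by blast
      show "\<exists>y\<in>X. d x y < \<epsilon> \<and> d x y + (u x - v y) < \<epsilon>"
      proof (cases "y \<in> X")
        case True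
        then show ?thesis using y x by (intro bexI[of _ y]) (auto simp: eq j)
      next
        \<comment> \<open>Here the extension of \<open>v\<close> vanishes at \<open>y\<close>, so \<open>u x\<close> is below \<open>\<epsilon>\<close> and \<open>x\<close> itself serves.\<close>
        case False
        then have "\<rho> x y + u x < \<epsilon>" using y x by (simp add: j j0)
        moreover have "0 \<le> \<rho> x y" by simp
        ultimately have "u x - v x < \<epsilon>" using v0[OF x] by linarith
        then show ?thesis using x \<open>0 < \<epsilon>\<close> by (intro bexI[of _ x]) auto
      qed
    qed
  next
    assume near: "X.endo_near \<epsilon> u v"
    show "Y.endo_near \<epsilon> (?j u) (?j v)"
      unfolding Y.endo_near_def Y.close_to_endo_def
    proof
      fix x assume x: "x \<in> Y"
      show "\<exists>y\<in>Y. \<rho> x y < \<epsilon> \<and> \<rho> x y + (?j u x - ?j v y) < \<epsilon>"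
      proof (cases "x \<in> X")
        case True
        then obtain y where "y \<in> X" "d x y < \<epsilon>" "d x y + (u x - v y) < \<epsilon>"
          using near unfolding X.endo_near_def X.close_to_endo_def by blast
        then show ?thesis using True sub by (intro bexI[of _ y]) (auto simp: j eq)
      next
        case False
        then show ?thesis using x \<open>0 < \<epsilon>\<close> by (intro bexI[of _ x]) (auto simp: j0)
      qed
    qed
  qed
qed

lemma H_end_zero_ext:
  assumes X: "Metric_space X d" and Y: "Metric_space Y \<rho>" and sub: "X \<subseteq> Y"
    and eq: "\<And>x y. x \<in> X \<Longrightarrow> y \<in> X \<Longrightarrow> \<rho> x y = d x y"
    and u: "u \<in> fuzzy_sets X" and v: "v \<in> fuzzy_sets X"
  shows "H_end Y \<rho> (zero_ext X Y u) (zero_ext X Y v) = H_end X d u v"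
proof -
  interpret X: Metric_space X d by fact
  interpret Y: Metric_space Y \<rho> by fact
  note near = endo_near_zero_ext[OF X Y sub eq]
  note ju = zero_ext_fuzzy[OF u, of Y] and jv = zero_ext_fuzzy[OF v, of Y]
  let ?u = "zero_ext X Y u" and ?v = "zero_ext X Y v"
  have nonneg: "0 \<le> H_end X d u v" "0 \<le> H_end Y \<rho> ?u ?v" by (auto simp: H_end_def)
  show ?thesis
  proof (rule antisym; rule field_le_epsilon)
    fix e :: real assume "0 < e"
    have "X.endo_near (H_end X d u v + e) u v" "X.endo_near (H_end X d u v + e) v u"
      using \<open>0 < e\<close> u v by (auto intro!: X.H_end_less_imp_endo_near simp: X.H_end_commute)
    then show "H_end Y \<rho> ?u ?v \<le> H_end X d u v + e"
      using nonneg \<open>0 < e\<close> u v ju jv by (intro Y.endo_near_imp_H_end_le) (auto simp: near)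
  next
    fix e :: real assume "0 < e"
    have "Y.endo_near (H_end Y \<rho> ?u ?v + e) ?u ?v" "Y.endo_near (H_end Y \<rho> ?u ?v + e) ?v ?u"
      using \<open>0 < e\<close> ju jv by (auto intro!: Y.H_end_less_imp_endo_near simp: Y.H_end_commute)
    then show "H_end X d u v \<le> H_end Y \<rho> ?u ?v + e"
      using nonneg \<open>0 < e\<close> u v by (intro X.endo_near_imp_H_end_le) (auto simp: near)
  qed
qed

section \<open>Density\<close>

lemma (in Metric_space) dense_covers_compactin:
  assumes "mtopology closure_of X = M" "X \<subseteq> M" "compactin mtopology C" "0 < \<epsilon>"
  obtains G where "finite G" "G \<subseteq> X" "C \<subseteq> (\<Union>y\<in>G. mball y \<epsilon>)"
proof -
  have "C \<subseteq> (\<Union>y\<in>X. mball y \<epsilon>)"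
  proof
    fix x assume "x \<in> C"
    then have "x \<in> mtopology closure_of X"
      using assms(1,3) compactin_subset_topspace by fastforce
    then obtain y where "y \<in> X" "y \<in> mball x \<epsilon>"
      unfolding metric_closure_of using \<open>0 < \<epsilon>\<close> by blast
    then show "x \<in> (\<Union>y\<in>X. mball y \<epsilon>)" by (auto simp: commute)
  qed
  then obtain \<F> where \<F>: "finite \<F>" "\<F> \<subseteq> (\<lambda>y. mball y \<epsilon>) ` X" "C \<subseteq> \<Union>\<F>"
    using compactinD[OF assms(3), of "(\<lambda>y. mball y \<epsilon>) ` X"] by auto
  then obtain G where "G \<subseteq> X" "finite G" "\<F> = (\<lambda>y. mball y \<epsilon>) ` G"
    by (meson finite_subset_image)
  with \<F> that show thesis by blast
qed

text \<open>The approximation has finite support, so its positive cuts are finite and hence compact in \<open>X\<close>.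
  At points where \<open>v < \<epsilon>\<close> the axis is close enough; the other points lie in the ball around some
  centre, whose value dominates theirs. Conversely the value at a centre is nearly attained by \<open>v\<close>
  inside the ball.\<close>

lemma zero_ext_dense:
  assumes X: "Metric_space X d" and Y: "Metric_space Y \<rho>" and sub: "X \<subseteq> Y"
    and dense: "Metric_space.mtopology Y \<rho> closure_of X = Y"
    and v: "v \<in> F_USCG Y \<rho>" and \<epsilon>: "0 < \<epsilon>" "\<epsilon> \<le> 1"
  shows "\<exists>u\<in>F_USCG X d. H_end Y \<rho> v (zero_ext X Y u) \<le> 2*\<epsilon>"
proof -
  interpret X: Metric_space X d by fact
  interpret Y: Metric_space Y \<rho> by fact
  have "compactin Y.mtopology {x \<in> Y. \<epsilon> \<le> v x}"
    by (rule Y.F_USCG_cut_compactin[OF v \<epsilon>])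
  then obtain G where G: "finite G" "G \<subseteq> X" and cover: "{x \<in> Y. \<epsilon> \<le> v x} \<subseteq> (\<Union>y\<in>G. Y.mball y \<epsilon>)"
    using Y.dense_covers_compactin[OF dense sub] \<epsilon> by blast
  have v01: "0 \<le> v x" "v x \<le> 1" if "x \<in> Y" for x
    using Y.F_USCG_fuzzy[OF v] that by (auto simp: fuzzy_sets_def PiE_iff)
  define s where "s y = Sup (v ` Y.mball y \<epsilon>)" for y
  have bdd: "bdd_above (v ` Y.mball y \<epsilon>)" for y
    using v01 by (auto intro!: bdd_aboveI[of _ 1])
  have s_upper: "v x \<le> s y" if "x \<in> Y.mball y \<epsilon>" for x y
    unfolding s_def using that bdd by (intro cSup_upper) auto
  have s01: "0 \<le> s y" "s y \<le> 1" if "y \<in> Y" for y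
  proof -
    have "y \<in> Y.mball y \<epsilon>" using that \<epsilon> by simp
    then show "0 \<le> s y" using s_upper v01 that order_trans by blast
    show "s y \<le> 1"
      unfolding s_def
    proof (rule cSup_least)
      show "v ` Y.mball y \<epsilon> \<noteq> {}" using \<open>y \<in> Y.mball y \<epsilon>\<close> by blast
    qed (use v01 in auto)
  qed
  define u where "u = (\<lambda>y\<in>X. if y \<in> G then s y else 0)"
  have u_fuzzy: "u \<in> fuzzy_sets X"
    using s01 sub by (auto simp: fuzzy_sets_def u_def)
  have "\<exists>x\<in>X. u x = 1"
  proof -
    obtain x where x: "x \<in> Y" "v x = 1" using v by (auto simp: Y.F_USCG_iff)
    then have "x \<in> {x \<in> Y. \<epsilon> \<le> v x}" using \<epsilon> by simp
    then obtain y where y: "y \<in> G" "x \<in> Y.mball y \<epsilon>" using cover by blast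
    then have "y \<in> X" "y \<in> Y" using G sub by auto
    moreover have "s y = 1" using s_upper[OF y(2)] x s01[OF \<open>y \<in> Y\<close>] by simp
    ultimately show ?thesis using y by (intro bexI[of _ y]) (auto simp: u_def)
  qed
  moreover have "compactin X.mtopology {x \<in> X. \<alpha> \<le> u x}" if "0 < \<alpha>" for \<alpha>
  proof (rule finite_imp_compactin)
    have "{x \<in> X. \<alpha> \<le> u x} \<subseteq> G" using that by (auto simp: u_def split: if_splits)
    then show "finite {x \<in> X. \<alpha> \<le> u x}" using G finite_subset by blast
  qed auto
  ultimately have u: "u \<in> F_USCG X d"
    using u_fuzzy by (auto simp: X.F_USCG_iff)
  let ?u = "zero_ext X Y u"
  have u_eq: "?u y = (if y \<in> G then s y else 0)" if "y \<in> Y" for y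
    using that G by (auto simp: zero_ext_def u_def)
  have "Y.endo_near (2*\<epsilon>) v ?u"
    unfolding Y.endo_near_def Y.close_to_endo_def
  proof
    fix x assume x: "x \<in> Y"
    show "\<exists>y\<in>Y. \<rho> x y < 2*\<epsilon> \<and> \<rho> x y + (v x - ?u y) < 2*\<epsilon>"
    proof (cases "\<epsilon> \<le> v x")
      case True
      then obtain y where y: "y \<in> G" "x \<in> Y.mball y \<epsilon>" using cover x by blast
      then show ?thesis
        using s_upper[OF y(2)] \<epsilon> u_eq[of y] Y.commute[of x y] by (intro bexI[of _ y]) auto
    next
      case False
      then show ?thesis
        using x \<epsilon> u_eq[OF x] s01[OF x] by (intro bexI[of _ x]) auto
    qed
  qed
  moreover have "Y.endo_near (2*\<epsilon>) ?u v"
    unfolding Y.endo_near_def Y.close_to_endo_def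
  proof
    fix y assume y: "y \<in> Y"
    show "\<exists>x\<in>Y. \<rho> y x < 2*\<epsilon> \<and> \<rho> y x + (?u y - v x) < 2*\<epsilon>"
    proof (cases "y \<in> G")
      case True
      have "v ` Y.mball y \<epsilon> \<noteq> {}" using y \<epsilon> Y.centre_in_mball_iff by blast
      moreover have "s y - \<epsilon> < Sup (v ` Y.mball y \<epsilon>)" using \<epsilon> by (simp add: s_def)
      ultimately obtain x where "x \<in> Y.mball y \<epsilon>" "s y - \<epsilon> < v x"
        using less_cSupD[of "v ` Y.mball y \<epsilon>" "s y - \<epsilon>"] by blast
      then show ?thesis using True u_eq[OF y] \<epsilon> by (intro bexI[of _ x]) auto
    next
      case False
      then show ?thesis using y \<epsilon> u_eq[OF y] v01[OF y] by (intro bexI[of _ y]) auto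
    qed
  qed
  ultimately have "H_end Y \<rho> v ?u \<le> 2*\<epsilon>"
    using Y.F_USCG_fuzzy[OF v] zero_ext_fuzzy[OF u_fuzzy] \<epsilon>
    by (intro Y.endo_near_imp_H_end_le) auto
  with u show ?thesis by blast
qed

section \<open>The completion theorem\<close>

theorem corollary8p10:
  fixes X Xt :: "'a set" and d dt :: "'a \<Rightarrow> 'a \<Rightarrow> real"
  assumes "X \<noteq> {}"
    and "metric_completion X d Xt dt (\<lambda>x. x)"
  shows "metric_completion (F_USCG X d) (H_end X d) (F_USCG Xt dt) (H_end Xt dt) (zero_ext X Xt)"
proof -
  have X: "Metric_space X d" and Y: "Metric_space Xt dt"
    and complete: "Metric_space.mcomplete Xt dt" and sub: "X \<subseteq> Xt"
    and eq: "\<And>x y. x \<in> X \<Longrightarrow> y \<in> X \<Longrightarrow> dt x y = d x y"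
    and dense: "Metric_space.mtopology Xt dt closure_of X = Xt"
    using assms(2) unfolding metric_completion_def by auto
  note FX = Metric_space.Metric_space_F_USCG[OF X] and FY = Metric_space.Metric_space_F_USCG[OF Y]
  interpret FY: Metric_space "F_USCG Xt dt" "H_end Xt dt" by (rule FY)
  note emb = zero_ext_F_USCG[OF X Y sub eq]
  have "F_USCG Xt dt \<subseteq> FY.mtopology closure_of (zero_ext X Xt ` F_USCG X d)"
    unfolding FY.metric_closure_of
  proof clarsimp
    fix v and r :: real assume v: "v \<in> F_USCG Xt dt" and r: "0 < r"
    define \<epsilon> where "\<epsilon> = min 1 (r/3)"
    have \<epsilon>: "0 < \<epsilon>" "\<epsilon> \<le> 1" "2*\<epsilon> < r" using r by (auto simp: \<epsilon>_def)
    obtain u where u: "u \<in> F_USCG X d" "H_end Xt dt v (zero_ext X Xt u) \<le> 2*\<epsilon>"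
      using zero_ext_dense[OF X Y sub dense v \<epsilon>(1,2)] by blast
    then show "\<exists>u\<in>F_USCG X d. zero_ext X Xt u \<in> F_USCG Xt dt \<and> H_end Xt dt v (zero_ext X Xt u) < r"
      using \<epsilon> emb by (intro bexI[of _ u]) auto
  qed
  then have "FY.mtopology closure_of (zero_ext X Xt ` F_USCG X d) = F_USCG Xt dt"
    using closure_of_subset_topspace[of FY.mtopology] by auto
  then show ?thesis
    unfolding metric_completion_def
    using FX FY Metric_space.mcomplete_F_USCG[OF Y complete] emb
      H_end_zero_ext[OF X Y sub eq] Metric_space.F_USCG_fuzzy[OF X]
    by auto
qed

end
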